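(* Let $L$ be a linear pencil of size $m$ in the variables $X=(X_1,\dots,X_n)$, with associated spectrahedron $S_L\subseteq\mathbb{R}^n$ and quadratic module $M_L\subseteq\mathbb{R}[X]$. Then $$S_L=\emptyset\quad\Longleftrightarrow\quad -1\in M_L.$$
   Context: $\mathbb{R}[X]=\mathbb{R}[X_1,\dots,X_n]$ is the real polynomial ring in $n$ commuting variables. A linear pencil of size $m$ is a symmetric $m\times m$ matrix whose entries are polynomials in $\mathbb{R}[X]$ of degree at most $1$; equivalently $L=A_0+\sum_{i=1}^n X_iA_i$ with $A_0,\dots,A_n$ real symmetric $m\times m$ matrices. $A^*$ denotes the transpose, and $A\succeq0$ means that $A$ is real symmetric positive semidefinite. The spectrahedron of $L$ is $S_L=\{x\in\mathbb{R}^n\mid L(x)\succeq0\}$. The quadratic module of $L$ is $$M_L=\Big\{\sum_i p_i^2+\sum_j v_j^*Lv_j\ \Big|\ p_i\in\mathbb{R}[X],\ v_j\in\mathbb{R}[X]^m\Big\}\subseteq\mathbb{R}[X]$$ (all sums finite). *)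

theory Defs
  imports "HOL-Analysis.Analysis" "HOL-Library.Poly_Mapping"
begin

text \<open>
  Polynomials are finitely supported functions from monomials (exponent vectors) to
  coefficients; multiplication on this type is convolution, so \<^typ>\<open>('n \<Rightarrow>\<^sub>0 nat) \<Rightarrow>\<^sub>0 real\<close>
  is the commutative ring of real polynomials in variables indexed by \<^typ>\<open>'n\<close>.
\<close>

type_synonym 'n rpoly = "('n \<Rightarrow>\<^sub>0 nat) \<Rightarrow>\<^sub>0 real"

definition monom_degree :: "('n::finite \<Rightarrow>\<^sub>0 nat) \<Rightarrow> nat" where
  "monom_degree a = (\<Sum>i\<in>UNIV. Poly_Mapping.lookup a i)"

text \<open>The zero polynomial gets degree 0.\<close>

definition total_degree :: "'n::finite rpoly \<Rightarrow> nat" where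
  "total_degree p = Max (insert 0 (monom_degree ` Poly_Mapping.keys p))"

definition eval_rpoly :: "'n::finite rpoly \<Rightarrow> real ^ 'n \<Rightarrow> real" where
  "eval_rpoly p x =
     (\<Sum>a\<in>Poly_Mapping.keys p.
        Poly_Mapping.lookup p a * (\<Prod>i\<in>UNIV. (x $ i) ^ Poly_Mapping.lookup a i))"

definition linear_pencil :: "'n::finite rpoly ^ 'm ^ 'm \<Rightarrow> bool" where
  "linear_pencil L \<longleftrightarrow> transpose L = L \<and> (\<forall>i j. total_degree (L $ i $ j) \<le> 1)"

definition eval_pencil :: "'n::finite rpoly ^ 'm ^ 'm \<Rightarrow> real ^ 'n \<Rightarrow> real ^ 'm ^ 'm" where
  "eval_pencil L x = (\<chi> i j. eval_rpoly (L $ i $ j) x)"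

definition pos_semidef :: "real ^ 'm ^ 'm \<Rightarrow> bool" where
  "pos_semidef A \<longleftrightarrow> transpose A = A \<and> (\<forall>v. 0 \<le> v \<bullet> (A *v v))"

definition spectrahedron :: "'n::finite rpoly ^ 'm ^ 'm \<Rightarrow> (real ^ 'n) set" where
  "spectrahedron L = {x. pos_semidef (eval_pencil L x)}"

text \<open>
  The value \<open>v\<^sup>* L v\<close> as a polynomial; the inner product of the library is not available
  here because it is restricted to real inner product spaces.
\<close>

definition quad_form :: "'n::finite rpoly ^ 'm ^ 'm \<Rightarrow> 'n rpoly ^ 'm \<Rightarrow> 'n rpoly" where
  "quad_form L v = (\<Sum>i\<in>UNIV. v $ i * (L *v v) $ i)"

definition quadratic_module :: "'n::finite rpoly ^ 'm ^ 'm \<Rightarrow> 'n rpoly set" where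
  "quadratic_module L = {(\<Sum>p\<leftarrow>ps. p ^ 2) + (\<Sum>v\<leftarrow>vs. quad_form L v) | ps vs. True}"

end

theory Submission
  imports Defs
begin

text \<open>
  A point \<open>x\<close> of the spectrahedron makes every element of \<open>M\<^sub>L\<close> nonnegative at \<open>x\<close>, so \<open>-1\<close> is not
  in \<open>M\<^sub>L\<close>. For the converse, suppose \<open>-1 \<notin> M\<^sub>L\<close>; a point of the spectrahedron is constructed.

  By Zorn's lemma, \<open>M\<^sub>L\<close> lies in a quadratic module \<open>N\<close> that is maximal among those without \<open>-1\<close>.
  Maximality makes \<open>N\<close> real: \<open>-p\<^sup>2 \<in> N\<close> implies \<open>p \<in> N\<close> (\<open>maximal_quadratic_module_real\<close>). Think of
  the elements of \<open>N\<close> as the polynomials declared nonnegative, and of \<open>N \<inter> -N\<close> as those declared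
  zero. This declaration need not come from a point, but its restriction to the finite-dimensional
  space of affine polynomials can be corrected to one that does, by strict separation from a
  compact set. Identify affine polynomials with pairs \<open>(c, a)\<close> in \<open>\<real> \<times> \<real>\<^sup>n\<close>. The affine
  polynomials in \<open>N\<close> form a convex cone \<open>E\<close> with lineality space \<open>W = E \<inter> -E\<close>. For constant
  vectors \<open>u\<close> the polynomials \<open>u\<^sup>*Lu\<close> are affine and lie in \<open>E\<close>.

  Let \<open>K\<close> be the space of the constant vectors \<open>u\<close> with \<open>u\<^sup>*Lw \<in> W\<close> for all constant \<open>w\<close>. Reality of
  \<open>N\<close> yields a Cauchy-Schwarz property (\<open>bilin_mem_of_isotropic\<close>): if \<open>u\<^sup>*Lu \<in> W\<close>, then \<open>u \<in> K\<close>.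
  Hence the compact set \<open>S\<close> consisting of \<open>1\<close> and of all \<open>u\<^sup>*Lu\<close> with \<open>u\<close> a unit vector orthogonal to \<open>K\<close>
  is contained in \<open>E - W\<close>. Separation (\<open>exists_functional_positive_on_compact\<close>) gives a linear
  functional that is positive on \<open>S\<close> and zero on \<open>W\<close>. It is positive at the polynomial \<open>1\<close>, so
  after scaling it is evaluation of affine polynomials at a point \<open>x\<close>. The matrix \<open>L(x)\<close>
  annihilates \<open>K\<close> and is positive definite on the orthogonal complement of \<open>K\<close>, so it is
  positive semidefinite.
\<close>

section \<open>Quadratic modules in a commutative ring\<close>

definition is_quadratic_module :: "'a::comm_ring_1 set \<Rightarrow> bool" where
  "is_quadratic_module M \<longleftrightarrow>
     1 \<in> M \<and> (\<forall>p\<in>M. \<forall>q\<in>M. p + q \<in> M) \<and> (\<forall>p\<in>M. \<forall>r. r\<^sup>2 * p \<in> M)"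

lemma is_quadratic_moduleD:
  assumes "is_quadratic_module M"
  shows "1 \<in> M" and "p \<in> M \<Longrightarrow> q \<in> M \<Longrightarrow> p + q \<in> M" and "p \<in> M \<Longrightarrow> r\<^sup>2 * p \<in> M"
    and "0 \<in> M" and "r\<^sup>2 \<in> M"
proof -
  have one: "1 \<in> M" and mult: "p \<in> M \<Longrightarrow> r\<^sup>2 * p \<in> M" for p r
    using assms by (auto simp: is_quadratic_module_def)
  show "1 \<in> M" "p \<in> M \<Longrightarrow> q \<in> M \<Longrightarrow> p + q \<in> M" "p \<in> M \<Longrightarrow> r\<^sup>2 * p \<in> M"
    using assms by (auto simp: is_quadratic_module_def)
  show "0 \<in> M" using mult[OF one, of 0] by simp
  show "r\<^sup>2 \<in> M" using mult[OF one, of r] by simp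
qed

lemma is_quadratic_module_Union_chain:
  assumes chain: "subset.chain {N. is_quadratic_module N \<and> P N} C" and "C \<noteq> {}"
  shows "is_quadratic_module (\<Union>C)"
  unfolding is_quadratic_module_def
proof (intro conjI ballI allI)
  have C: "is_quadratic_module N" if "N \<in> C" for N
    using chain that by (auto simp: subset.chain_def)
  show "1 \<in> \<Union>C"
    using \<open>C \<noteq> {}\<close> C is_quadratic_moduleD(1) by blast
  show "p + q \<in> \<Union>C" if pq: "p \<in> \<Union>C" "q \<in> \<Union>C" for p q
  proof -
    obtain A B where AB: "A \<in> C" "B \<in> C" "p \<in> A" "q \<in> B" using pq by blast
    then have "A \<subseteq> B \<or> B \<subseteq> A" using chain by (auto simp: subset.chain_def)
    then show ?thesis using AB C is_quadratic_moduleD(2) by blast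
  qed
  show "r\<^sup>2 * p \<in> \<Union>C" if "p \<in> \<Union>C" for p r
    using that C is_quadratic_moduleD(3) by blast
qed

lemma exists_maximal_proper_quadratic_module:
  assumes "is_quadratic_module M" and "-1 \<notin> M"
  obtains N where "M \<subseteq> N" "is_quadratic_module N" "-1 \<notin> N"
    and "\<And>N'. is_quadratic_module N' \<Longrightarrow> -1 \<notin> N' \<Longrightarrow> N \<subseteq> N' \<Longrightarrow> N' = N"
proof -
  define A where "A = {N. is_quadratic_module N \<and> (M \<subseteq> N \<and> -1 \<notin> N)}"
  have "\<exists>N\<in>A. \<forall>X\<in>A. N \<subseteq> X \<longrightarrow> X = N"
  proof (rule subset_Zorn_nonempty)
    show "A \<noteq> {}" using assms by (auto simp: A_def)
    show "\<Union>C \<in> A" if "C \<noteq> {}" and chain: "subset.chain A C" for C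
    proof -
      have "C \<subseteq> A" using chain by (auto simp: subset.chain_def)
      then show ?thesis
        using is_quadratic_module_Union_chain[OF chain[unfolded A_def] \<open>C \<noteq> {}\<close>] \<open>C \<noteq> {}\<close>
        by (auto simp: A_def)
    qed
  qed
  then obtain N where "N \<in> A" and max: "\<And>X. X \<in> A \<Longrightarrow> N \<subseteq> X \<Longrightarrow> X = N" by blast
  then have N: "M \<subseteq> N" "is_quadratic_module N" "-1 \<notin> N" by (auto simp: A_def)
  show thesis
  proof (rule that[OF N])
    fix N' assume N': "is_quadratic_module N'" "-1 \<notin> N'" "N \<subseteq> N'"
    then have "N' \<in> A" using N(1) by (auto simp: A_def)
    then show "N' = N" using max N'(3) by blast
  qed
qed

lemma is_quadratic_module_add_principal_ideal:
  assumes "is_quadratic_module N"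
  shows "is_quadratic_module {q + p * r | q r. q \<in> N}"
  unfolding is_quadratic_module_def
proof (intro conjI ballI allI)
  note N = is_quadratic_moduleD[OF assms]
  show "1 \<in> {q + p * r | q r. q \<in> N}"
    using N(1) by (intro CollectI exI[of _ 1] exI[of _ 0]) simp
  show "a + b \<in> {q + p * r | q r. q \<in> N}"
    if ab: "a \<in> {q + p * r | q r. q \<in> N}" "b \<in> {q + p * r | q r. q \<in> N}" for a b
  proof -
    obtain q r q' r' where "a = q + p * r" "b = q' + p * r'" "q \<in> N" "q' \<in> N"
      using ab by blast
    then show ?thesis
      using N(2) by (intro CollectI exI[of _ "q + q'"] exI[of _ "r + r'"]) (simp add: algebra_simps)
  qed
  show "c\<^sup>2 * a \<in> {q + p * r | q r. q \<in> N}" if a: "a \<in> {q + p * r | q r. q \<in> N}" for a c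
  proof -
    obtain q r where "a = q + p * r" "q \<in> N" using a by blast
    then show ?thesis
      using N(3) by (intro CollectI exI[of _ "c\<^sup>2 * q"] exI[of _ "c\<^sup>2 * r"]) (simp add: algebra_simps)
  qed
qed

text \<open>
  If \<open>p\<close> were not in \<open>N\<close>, then by maximality adjoining the ideal of \<open>p\<close> would produce \<open>-1 = q + p r\<close>
  with \<open>q \<in> N\<close>. But \<open>2 q + (1 + p r)\<^sup>2 - r\<^sup>2 p\<^sup>2\<close> lies in \<open>N\<close>, and it equals
  \<open>2 (q + p r) + 1 = -1\<close>.
\<close>

lemma maximal_quadratic_module_real:
  assumes N: "is_quadratic_module N" "-1 \<notin> N"
    and max: "\<And>N'. is_quadratic_module N' \<Longrightarrow> -1 \<notin> N' \<Longrightarrow> N \<subseteq> N' \<Longrightarrow> N' = N"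
    and p: "- (p\<^sup>2) \<in> N"
  shows "p \<in> N"
proof -
  note ND = is_quadratic_moduleD[OF N(1)]
  let ?N' = "{q + p * r | q r. q \<in> N}"
  have "-1 \<notin> ?N'"
  proof
    assume "-1 \<in> ?N'"
    then obtain q r where qr: "-1 = q + p * r" "q \<in> N" by blast
    have "q + q + (1 + p * r)\<^sup>2 + r\<^sup>2 * (- (p\<^sup>2)) \<in> N"
      by (intro ND(2) ND(3) ND(5) p qr(2))
    also have "q + q + (1 + p * r)\<^sup>2 + r\<^sup>2 * (- (p\<^sup>2)) = (q + p * r) + (q + p * r) + 1"
      by (simp add: algebra_simps power2_eq_square)
    also have "\<dots> = -1"
      unfolding qr(1)[symmetric] by simp
    finally show False using N(2) by simp
  qed
  moreover have "N \<subseteq> ?N'"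
    by (rule subsetI, rule CollectI, rule exI, rule exI[of _ 0]) simp
  ultimately have "?N' = N"
    using max is_quadratic_module_add_principal_ideal[OF N(1)] by blast
  moreover have "p \<in> ?N'"
    using ND(4) by (intro CollectI exI[of _ 0] exI[of _ 1]) simp
  ultimately show ?thesis by simp
qed

section \<open>Matrices as bilinear forms over a commutative ring\<close>

definition bilin :: "'a::comm_ring_1 ^ 'm ^ 'm \<Rightarrow> 'a ^ 'm \<Rightarrow> 'a ^ 'm \<Rightarrow> 'a" where
  "bilin L v w = (\<Sum>i\<in>UNIV. \<Sum>j\<in>UNIV. v $ i * L $ i $ j * w $ j)"

lemma quad_form_eq_bilin: "quad_form L v = bilin L v v"
  by (simp add: quad_form_def bilin_def matrix_vector_mult_def sum_distrib_left mult.assoc)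

lemma inner_matrix_eq_bilin: "v \<bullet> (A *v v) = bilin A v v" for A :: "real ^ 'm::finite ^ 'm"
  by (simp add: inner_vec_def bilin_def matrix_vector_mult_def sum_distrib_left mult.assoc)

lemma bilin_add_left: "bilin L (u + v) w = bilin L u w + bilin L v w"
  by (simp add: bilin_def algebra_simps sum.distrib)

lemma bilin_add_right: "bilin L w (u + v) = bilin L w u + bilin L w v"
  by (simp add: bilin_def algebra_simps sum.distrib)

lemma bilin_scale_left: "bilin L (a *s v) w = a * bilin L v w"
  by (simp add: bilin_def sum_distrib_left mult_ac)

lemma bilin_scale_right: "bilin L v (a *s w) = a * bilin L v w"
  by (simp add: bilin_def sum_distrib_left mult_ac)

lemma symmetric_matrix_entry:
  assumes "transpose L = L"
  shows "L $ i $ j = L $ j $ i"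
proof -
  have "transpose L $ i $ j = L $ j $ i" by (simp add: transpose_def)
  then show ?thesis using assms by simp
qed

lemma bilin_commute:
  assumes "transpose L = L"
  shows "bilin L v w = bilin L w v"
proof -
  have "bilin L v w = (\<Sum>i\<in>UNIV. \<Sum>j\<in>UNIV. w $ j * L $ j $ i * v $ i)"
    unfolding bilin_def
    by (intro sum.cong refl) (simp add: symmetric_matrix_entry[OF assms] mult_ac)
  also have "\<dots> = bilin L w v"
    unfolding bilin_def by (rule sum.swap)
  finally show ?thesis .
qed

text \<open>
  An analogue of the fact that an isotropic vector of a positive semidefinite form lies in its
  kernel. With \<open>l = u\<^sup>*Lw\<close> and \<open>q = w\<^sup>*Lw\<close>, the form at \<open>a u + 2 l w\<close> is
  \<open>a\<^sup>2 u\<^sup>*Lu + 4 l\<^sup>2 (a + q)\<close>; the ring element \<open>a = -(q + 1)\<close> turns the last factor into \<open>-1\<close>.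
  Since \<open>-u\<^sup>*Lu \<in> N\<close>, this shows \<open>-(2 l)\<^sup>2 \<in> N\<close>, and reality of \<open>N\<close> applies. Working with \<open>2 l\<close>
  instead of \<open>l\<close> avoids dividing by \<open>2\<close> in the ring.
\<close>

lemma bilin_mem_of_isotropic:
  fixes L :: "'a::comm_ring_1 ^ 'm::finite ^ 'm"
  assumes N: "is_quadratic_module N"
    and real: "\<And>p. - (p\<^sup>2) \<in> N \<Longrightarrow> p \<in> N"
    and L: "transpose L = L" "\<And>v. bilin L v v \<in> N"
    and u: "- bilin L u u \<in> N"
  shows "2 * bilin L u w \<in> N" and "- (2 * bilin L u w) \<in> N"
proof -
  let ?l = "bilin L u w" and ?q = "bilin L w w"
  define v where "v = (2 * ?l) *s w + (- (?q + 1)) *s u"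
  have "bilin L v v = (2 * ?l)\<^sup>2 * ?q - 2 * (2 * ?l) * (?q + 1) * ?l + (?q + 1)\<^sup>2 * bilin L u u"
    unfolding v_def bilin_add_left bilin_add_right bilin_scale_left bilin_scale_right
      bilin_commute[OF L(1), of w u]
    by (simp add: algebra_simps power2_eq_square)
  then have "- ((2 * ?l)\<^sup>2) = bilin L v v + (?q + 1)\<^sup>2 * (- bilin L u u)"
    by (simp add: algebra_simps power2_eq_square)
  also have "\<dots> \<in> N"
    by (intro is_quadratic_moduleD(2,3)[OF N] L(2) u)
  finally have *: "- ((2 * ?l)\<^sup>2) \<in> N" .
  show "2 * ?l \<in> N" using real * by blast
  show "- (2 * ?l) \<in> N" using real[of "- (2 * ?l)"] * by simp
qed

section \<open>Evaluation of polynomials\<close>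

lemma eval_rpoly_superset:
  assumes "finite A" "Poly_Mapping.keys p \<subseteq> A"
  shows "eval_rpoly p x =
    (\<Sum>a\<in>A. Poly_Mapping.lookup p a * (\<Prod>i\<in>UNIV. (x $ i) ^ Poly_Mapping.lookup a i))"
  unfolding eval_rpoly_def
  by (rule sum.mono_neutral_left) (use assms in \<open>auto simp: in_keys_iff\<close>)

lemma eval_rpoly_zero [simp]: "eval_rpoly 0 x = 0"
  by (simp add: eval_rpoly_def)

lemma eval_rpoly_single:
  "eval_rpoly (Poly_Mapping.single a c) x = c * (\<Prod>i\<in>UNIV. (x $ i) ^ Poly_Mapping.lookup a i)"
  by (subst eval_rpoly_superset[of "{a}"]) auto

lemma eval_rpoly_one [simp]: "eval_rpoly 1 x = 1"
  using eval_rpoly_single[of 0 1 x] by simp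

lemma eval_rpoly_add: "eval_rpoly (p + q) x = eval_rpoly p x + eval_rpoly q x"
proof -
  let ?A = "Poly_Mapping.keys p \<union> Poly_Mapping.keys q"
  have "Poly_Mapping.keys (p + q) \<subseteq> ?A" by (rule keys_add)
  then show ?thesis
    by (simp add: eval_rpoly_superset[of ?A] lookup_add distrib_right sum.distrib)
qed

lemma eval_rpoly_uminus: "eval_rpoly (- p) x = - eval_rpoly p x"
  using eval_rpoly_add[of p "- p" x] by simp

lemma eval_rpoly_sum: "eval_rpoly (sum f A) x = (\<Sum>a\<in>A. eval_rpoly (f a) x)"
  by (induction A rule: infinite_finite_induct) (auto simp: eval_rpoly_add)

lemma eval_rpoly_sum_list: "eval_rpoly (sum_list ps) x = (\<Sum>p\<leftarrow>ps. eval_rpoly p x)"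
  by (induction ps) (auto simp: eval_rpoly_add)

lemma poly_mapping_eq_sum_single:
  "p = (\<Sum>a\<in>Poly_Mapping.keys p. Poly_Mapping.single a (Poly_Mapping.lookup p a))"
  by (rule poly_mapping_eqI) (auto simp: lookup_sum lookup_single when_def sum.delta' in_keys_iff)

lemma eval_rpoly_mult: "eval_rpoly (p * q) x = eval_rpoly p x * eval_rpoly q x"
proof -
  have "p * q = (\<Sum>a\<in>Poly_Mapping.keys p. \<Sum>b\<in>Poly_Mapping.keys q.
      Poly_Mapping.single (a + b) (Poly_Mapping.lookup p a * Poly_Mapping.lookup q b))"
    by (subst (1) poly_mapping_eq_sum_single[of p], subst (1) poly_mapping_eq_sum_single[of q])
      (simp add: sum_product mult_single)
  then show ?thesis
    by (simp add: eval_rpoly_sum eval_rpoly_single lookup_add power_add prod.distrib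
        eval_rpoly_def[of p] eval_rpoly_def[of q] sum_product mult_ac)
qed

lemma eval_rpoly_bilin:
  "eval_rpoly (bilin L v w) x =
    bilin (eval_pencil L x) (\<chi> i. eval_rpoly (v $ i) x) (\<chi> i. eval_rpoly (w $ i) x)"
  by (simp add: bilin_def eval_pencil_def eval_rpoly_sum eval_rpoly_mult)

section \<open>Affine polynomials\<close>

text \<open>
  Coefficient pairs rather than polynomials of degree at most \<open>1\<close> carry the convex geometry,
  because the product type is a Euclidean space.
\<close>

definition affine_poly :: "real \<times> (real ^ 'n) \<Rightarrow> 'n::finite rpoly" where
  "affine_poly z = Poly_Mapping.single 0 (fst z) +
     (\<Sum>i\<in>UNIV. Poly_Mapping.single (Poly_Mapping.single i 1) (snd z $ i))"

lemma affine_poly_one [simp]: "affine_poly (1, 0) = 1"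
  by (simp add: affine_poly_def)

lemma affine_poly_zero [simp]: "affine_poly 0 = 0"
  by (simp add: affine_poly_def)

lemma affine_poly_add: "affine_poly (y + z) = affine_poly y + affine_poly z"
  by (simp add: affine_poly_def single_add sum.distrib)

lemma affine_poly_scale: "affine_poly (c *\<^sub>R z) = Poly_Mapping.single 0 c * affine_poly z"
  by (simp add: affine_poly_def distrib_left sum_distrib_left mult_single)

lemma affine_poly_uminus: "affine_poly (- z) = - affine_poly z"
  using affine_poly_add[of z "- z"] by (simp add: eq_neg_iff_add_eq_0 add.commute)

lemma affine_poly_sum: "affine_poly (sum f A) = (\<Sum>a\<in>A. affine_poly (f a))"
  by (induction A rule: infinite_finite_induct) (auto simp: affine_poly_add)

lemma eval_affine_poly: "eval_rpoly (affine_poly z) x = fst z + snd z \<bullet> x"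
proof -
  have "(\<Prod>j\<in>UNIV. (x $ j) ^ Poly_Mapping.lookup (Poly_Mapping.single i (1::nat)) j) = x $ i" for i
  proof -
    have "(\<Prod>j\<in>UNIV. (x $ j) ^ Poly_Mapping.lookup (Poly_Mapping.single i (1::nat)) j)
        = (\<Prod>j\<in>UNIV. if j = i then x $ j else 1)"
      by (intro prod.cong) (auto simp: lookup_single when_def)
    then show ?thesis by simp
  qed
  then show ?thesis
    by (simp add: affine_poly_def eval_rpoly_add eval_rpoly_sum eval_rpoly_single inner_vec_def)
qed

lemma monom_degree_le_1:
  assumes "monom_degree a \<le> 1"
  shows "a = 0 \<or> (\<exists>i. a = Poly_Mapping.single i 1)"
proof (cases "a = 0")
  case False
  then obtain i where i: "Poly_Mapping.lookup a i \<noteq> 0"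
    by (metis poly_mapping_eqI lookup_zero)
  have "monom_degree a = Poly_Mapping.lookup a i + (\<Sum>j\<in>UNIV - {i}. Poly_Mapping.lookup a j)"
    unfolding monom_degree_def by (rule sum.remove) auto
  with assms i have "Poly_Mapping.lookup a i = 1"
    and "(\<Sum>j\<in>UNIV - {i}. Poly_Mapping.lookup a j) = 0" by linarith+
  then have "a = Poly_Mapping.single i 1"
    by (intro poly_mapping_eqI) (auto simp: lookup_single when_def)
  then show ?thesis by blast
qed simp

lemma affine_poly_of_total_degree_le_1:
  fixes p :: "'n::finite rpoly"
  assumes "total_degree p \<le> 1"
  shows "\<exists>z. p = affine_poly z"
proof -
  let ?e = "\<lambda>i::'n. Poly_Mapping.single i (1::nat)"
  have "monom_degree a \<le> 1" if "a \<in> Poly_Mapping.keys p" for a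
  proof -
    have "monom_degree a \<le> total_degree p"
      unfolding total_degree_def by (rule Max_ge) (use that in auto)
    then show ?thesis using assms by linarith
  qed
  then have sub: "a = 0 \<or> (\<exists>i. a = ?e i)" if "Poly_Mapping.lookup p a \<noteq> 0" for a
    using monom_degree_le_1[of a] that by (simp add: in_keys_iff)
  have e0: "?e i \<noteq> 0" for i
    by (metis lookup_single_eq lookup_zero one_neq_zero)
  have inj: "?e i = ?e j \<longleftrightarrow> i = j" for i j
    by (metis lookup_single_eq lookup_single_not_eq one_neq_zero)
  have "p = affine_poly (Poly_Mapping.lookup p 0, \<chi> i. Poly_Mapping.lookup p (?e i))"
  proof (rule poly_mapping_eqI)
    fix a
    consider "a = 0" | i where "a = ?e i" | "a \<noteq> 0" "\<And>i. a \<noteq> ?e i" by blast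
    then show "Poly_Mapping.lookup p a = Poly_Mapping.lookup
        (affine_poly (Poly_Mapping.lookup p 0, \<chi> i. Poly_Mapping.lookup p (?e i))) a"
    proof cases
      case 1
      then show ?thesis using e0
        by (simp add: affine_poly_def lookup_add lookup_sum lookup_single when_def)
    next
      case (2 i)
      then show ?thesis using e0[of i] inj
        by (simp add: affine_poly_def lookup_add lookup_sum lookup_single when_def)
    next
      case 3
      then have "Poly_Mapping.lookup p a = 0" using sub by blast
      moreover have "0 \<noteq> a" "?e i \<noteq> a" for i using 3 by metis+
      ultimately show ?thesis
        by (simp add: affine_poly_def lookup_add lookup_sum lookup_single when_def)
    qed
  qed
  then show ?thesis by blast
qed

section \<open>Separation\<close>

lemma subspace_lineality_space:
  assumes E: "convex_cone E"
  shows "subspace {w \<in> E. - w \<in> E}"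
proof (rule subspaceI)
  show "0 \<in> {w \<in> E. - w \<in> E}"
    using convex_cone_contains_0[OF E] by simp
  show "x + y \<in> {w \<in> E. - w \<in> E}" if "x \<in> {w \<in> E. - w \<in> E}" "y \<in> {w \<in> E. - w \<in> E}" for x y
    using that convex_cone_add[OF E, of x y] convex_cone_add[OF E, of "- x" "- y"] by simp
  show "c *\<^sub>R x \<in> {w \<in> E. - w \<in> E}" if "x \<in> {w \<in> E. - w \<in> E}" for c x
    using that convex_cone_scaleR[OF E, of "\<bar>c\<bar>" x] convex_cone_scaleR[OF E, of "\<bar>c\<bar>" "- x"]
    by (cases "c \<ge> 0") auto
qed

text \<open>
  The lineality space \<open>W\<close> is closed although \<open>E\<close> need not be, and \<open>conv S\<close> is compact, so
  \<open>conv S + W\<close> is closed. It misses the origin because the vectors of \<open>E\<close> outside \<open>W\<close> form a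
  convex set. A hyperplane strictly separating it from the origin gives the functional; being
  bounded below on translates of \<open>W\<close>, it vanishes on \<open>W\<close>.
\<close>

lemma exists_functional_positive_on_compact:
  fixes E :: "'a::euclidean_space set"
  assumes E: "convex_cone E"
    and S: "compact S" "S \<noteq> {}" "S \<subseteq> E - uminus ` E"
  obtains a where "\<And>z. z \<in> S \<Longrightarrow> 0 < a \<bullet> z"
    and "\<And>w. w \<in> E \<Longrightarrow> - w \<in> E \<Longrightarrow> a \<bullet> w = 0"
proof -
  have add: "y + z \<in> E" if "y \<in> E" "z \<in> E" for y z
    using E that by (simp add: convex_cone_add)
  have scale: "c *\<^sub>R z \<in> E" if "z \<in> E" "0 \<le> c" for c z
    using E that by (simp add: convex_cone_scaleR)
  define W where "W = {w \<in> E. - w \<in> E}"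
  have W: "subspace W"
    unfolding W_def by (rule subspace_lineality_space[OF E])
  \<comment> \<open>If the negative of a convex combination is in the cone, then adding one of the two terms
    shows that the negative of the other term is in the cone as well.\<close>
  have "convex {z \<in> E. - z \<notin> E}"
  proof (rule convexI)
    fix y z and s t :: real
    assume yz: "y \<in> {z \<in> E. - z \<notin> E}" "z \<in> {z \<in> E. - z \<notin> E}" and st: "0 \<le> s" "0 \<le> t" "s + t = 1"
    have absorb: "- y' \<in> E" if "0 < c" "d \<in> E" "- (c *\<^sub>R y' + d) \<in> E" for c y' d
    proof -
      have "- (c *\<^sub>R y') \<in> E" using add[OF that(3,2)] by simp
      from scale[OF this, of "1 / c"] show ?thesis using that(1) by simp
    qed
    have "- (s *\<^sub>R y + t *\<^sub>R z) \<notin> E"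
    proof
      assume *: "- (s *\<^sub>R y + t *\<^sub>R z) \<in> E"
      have "0 < s \<or> 0 < t" using st by linarith
      then show False
      proof
        assume "0 < s"
        then show False using absorb[of s "t *\<^sub>R z" y] * yz scale st by simp
      next
        assume "0 < t"
        then show False using absorb[of t "s *\<^sub>R y" z] * yz scale st by (simp add: add.commute)
      qed
    qed
    then show "s *\<^sub>R y + t *\<^sub>R z \<in> {z \<in> E. - z \<notin> E}" using yz st add scale by simp
  qed
  moreover have "S \<subseteq> {z \<in> E. - z \<notin> E}"
    using S(3) by (force simp: image_iff)
  ultimately have hull: "convex hull S \<subseteq> {z \<in> E. - z \<notin> E}"
    by (simp add: hull_minimal)
  define T where "T = (\<Union>h\<in>convex hull S. \<Union>w\<in>W. {h + w})"
  have "closed T"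
    unfolding T_def
    by (rule compact_closed_sums) (use S(1) W compact_convex_hull closed_subspace in auto)
  moreover have "convex T"
    unfolding T_def by (intro convex_sums convex_convex_hull subspace_imp_convex W)
  moreover have "0 \<notin> T"
  proof
    assume "0 \<in> T"
    then obtain h w where "h \<in> convex hull S" "w \<in> W" "h + w = 0" by (auto simp: T_def)
    then show False using hull by (auto simp: W_def add_eq_0_iff)
  qed
  ultimately obtain a b where b: "0 < b" and T: "\<And>z. z \<in> T \<Longrightarrow> b < a \<bullet> z"
    using separating_hyperplane_closed_0[of T] by auto
  have pos: "b < a \<bullet> z + a \<bullet> w" if "z \<in> S" "w \<in> W" for z w
    using T[of "z + w"] that hull_inc[of z S convex] by (auto simp: T_def inner_add_right)
  show thesis
  proof
    show "0 < a \<bullet> z" if "z \<in> S" for z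
      using pos[OF that subspace_0[OF W]] b by simp
    show "a \<bullet> w = 0" if "w \<in> E" "- w \<in> E" for w
    proof (rule ccontr)
      assume "a \<bullet> w \<noteq> 0"
      obtain z where z: "z \<in> S" using S(2) by blast
      have "w \<in> W" using that by (simp add: W_def)
      then have "(- (a \<bullet> z) / (a \<bullet> w)) *\<^sub>R w \<in> W" by (rule subspace_scale[OF W])
      \<comment> \<open>the multiple of \<open>w\<close> is chosen such that its functional value cancels that of \<open>z\<close>\<close>
      from pos[OF z this] show False using b \<open>a \<bullet> w \<noteq> 0\<close> by simp
    qed
  qed
qed

section \<open>The spectrahedron of a linear pencil\<close>

lemma is_quadratic_module_quadratic_module: "is_quadratic_module (quadratic_module L)"
  unfolding is_quadratic_module_def
proof (intro conjI ballI allI)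
  show "1 \<in> quadratic_module L"
    unfolding quadratic_module_def
    by (rule CollectI, rule exI[of _ "[1]"], rule exI[of _ "[]"]) simp
  show "p + q \<in> quadratic_module L" if pq: "p \<in> quadratic_module L" "q \<in> quadratic_module L" for p q
  proof -
    obtain ps vs ps' vs' where "p = (\<Sum>p\<leftarrow>ps. p ^ 2) + (\<Sum>v\<leftarrow>vs. quad_form L v)"
      "q = (\<Sum>p\<leftarrow>ps'. p ^ 2) + (\<Sum>v\<leftarrow>vs'. quad_form L v)"
      using pq unfolding quadratic_module_def by blast
    then show ?thesis
      unfolding quadratic_module_def
      by (intro CollectI exI[of _ "ps @ ps'"] exI[of _ "vs @ vs'"]) (simp add: add_ac)
  qed
  show "r\<^sup>2 * p \<in> quadratic_module L" if p: "p \<in> quadratic_module L" for p r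
  proof -
    obtain ps vs where "p = (\<Sum>p\<leftarrow>ps. p ^ 2) + (\<Sum>v\<leftarrow>vs. quad_form L v)"
      using p unfolding quadratic_module_def by blast
    moreover have "quad_form L (r *s v) = r\<^sup>2 * quad_form L v" for v
      by (simp add: quad_form_eq_bilin bilin_scale_left bilin_scale_right power2_eq_square mult.assoc)
    ultimately show ?thesis
      unfolding quadratic_module_def
      by (intro CollectI exI[of _ "map ((*) r) ps"] exI[of _ "map ((*s) r) vs"])
        (simp add: distrib_left sum_list_const_mult o_def power_mult_distrib)
  qed
qed

lemma quad_form_in_quadratic_module: "quad_form L v \<in> quadratic_module L"
  unfolding quadratic_module_def
  by (rule CollectI, rule exI[of _ "[]"], rule exI[of _ "[v]"]) simp

lemma eval_quadratic_module_nonneg: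
  assumes "p \<in> quadratic_module L" "x \<in> spectrahedron L"
  shows "0 \<le> eval_rpoly p x"
proof -
  obtain ps vs where p: "p = (\<Sum>p\<leftarrow>ps. p ^ 2) + (\<Sum>v\<leftarrow>vs. quad_form L v)"
    using assms(1) unfolding quadratic_module_def by blast
  have "0 \<le> eval_rpoly (quad_form L v) x" for v
    using assms(2)
    by (simp add: quad_form_eq_bilin eval_rpoly_bilin spectrahedron_def pos_semidef_def
        flip: inner_matrix_eq_bilin)
  moreover have "0 \<le> eval_rpoly (q ^ 2) x" for q
    by (simp add: power2_eq_square eval_rpoly_mult)
  ultimately show ?thesis
    unfolding p eval_rpoly_add eval_rpoly_sum_list
    by (intro add_nonneg_nonneg sum_list_nonneg) auto
qed

text \<open>
  Here the cone of affine polynomials in \<open>N\<close> is separated as described at the beginning. Passing to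
  the complement of \<open>K\<close> is what makes strict separation possible: the forms \<open>u\<^sup>*Lu\<close> with \<open>u\<close> in \<open>K\<close>
  lie in \<open>W\<close>, where every admissible functional vanishes.
\<close>

lemma spectrahedron_nonempty_of_real_quadratic_module:
  fixes L :: "'n::finite rpoly ^ 'm::finite ^ 'm"
  assumes L: "linear_pencil L"
    and N: "is_quadratic_module N" "-1 \<notin> N"
    and real: "\<And>p. - (p\<^sup>2) \<in> N \<Longrightarrow> p \<in> N"
    and quad: "\<And>v. quad_form L v \<in> N"
  shows "spectrahedron L \<noteq> {}"
proof -
  note ND = is_quadratic_moduleD[OF N(1)]
  have sym: "transpose L = L" using L by (simp add: linear_pencil_def)
  have "\<forall>i j. \<exists>z. L $ i $ j = affine_poly z"
    using L affine_poly_of_total_degree_le_1 unfolding linear_pencil_def by blast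
  then obtain z where z: "\<And>i j. L $ i $ j = affine_poly (z i j)" by metis
  define cvec :: "real ^ 'm \<Rightarrow> 'n rpoly ^ 'm"
    where "cvec u = (\<chi> i. Poly_Mapping.single 0 (u $ i))" for u
  define b where "b u w = (\<Sum>i\<in>UNIV. \<Sum>j\<in>UNIV. (u $ i * w $ j) *\<^sub>R z i j)" for u w :: "real ^ 'm"
  have b: "affine_poly (b u w) = bilin L (cvec u) (cvec w)" for u w
  proof -
    have "affine_poly ((u $ i * w $ j) *\<^sub>R z i j) = cvec u $ i * L $ i $ j * cvec w $ j" for i j
    proof -
      have "Poly_Mapping.single 0 (u $ i * w $ j) = cvec u $ i * cvec w $ j"
        by (simp add: cvec_def mult_single)
      then show ?thesis by (simp add: affine_poly_scale z mult_ac)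
    qed
    then show ?thesis by (simp add: b_def bilin_def affine_poly_sum)
  qed
  have b_add: "b (u + v) w = b u w + b v w" "b w (u + v) = b w u + b w v" for u v w
    by (simp_all add: b_def algebra_simps sum.distrib)
  have b_scale: "b (c *\<^sub>R u) w = c *\<^sub>R b u w" "b u (c *\<^sub>R w) = c *\<^sub>R b u w" for c u w
    by (simp_all add: b_def scaleR_sum_right mult_ac)
  define E where "E = {y. affine_poly y \<in> N}"
  have E_scale: "c *\<^sub>R y \<in> E" if "y \<in> E" "0 \<le> c" for y c
  proof -
    \<comment> \<open>a nonnegative constant is a square, so quadratic modules are closed under scaling by it\<close>
    have "(Poly_Mapping.single 0 (sqrt c))\<^sup>2 * affine_poly y \<in> N"
      using that ND(3) by (simp add: E_def)
    then show ?thesis using that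
      by (simp add: E_def affine_poly_scale power2_eq_square mult_single)
  qed
  have E_add: "x + y \<in> E" if "x \<in> E" "y \<in> E" for x y
    using that ND(2) by (simp add: E_def affine_poly_add)
  have E: "convex_cone E"
    unfolding convex_cone_iff using E_scale E_add ND(4) by (auto simp: E_def)
  define W where "W = {y \<in> E. - y \<in> E}"
  have W: "subspace W"
    unfolding W_def by (rule subspace_lineality_space[OF E])
  define K where "K = {u. \<forall>w. b u w \<in> W}"
  have K: "subspace K"
  proof (rule subspaceI)
    show "0 \<in> K" using ND(4) by (simp add: K_def b_def W_def E_def)
  qed (auto simp: K_def b_add b_scale subspace_add[OF W] subspace_scale[OF W])
  have quadE: "b u u \<in> E" for u
    using quad[of "cvec u"] by (simp add: E_def b quad_form_eq_bilin)
  have isotropic: "u \<in> K" if "- b u u \<in> E" for u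
  proof -
    have "- bilin L (cvec u) (cvec u) \<in> N"
      using that by (simp add: E_def affine_poly_uminus b)
    note * = bilin_mem_of_isotropic[OF N(1) real sym quad[unfolded quad_form_eq_bilin] this]
    have "b u w \<in> W" for w
    proof -
      have two: "affine_poly (2 *\<^sub>R b u w) = 2 * bilin L (cvec u) (cvec w)"
        by (simp add: affine_poly_scale b)
      have "2 *\<^sub>R b u w \<in> W"
        using *[of "cvec w"] by (simp add: W_def E_def two affine_poly_uminus)
      from subspace_scale[OF W this, of "1/2"] show ?thesis by simp
    qed
    then show ?thesis by (simp add: K_def)
  qed
  \<comment> \<open>The pair \<open>(1, 0)\<close>, which is the polynomial \<open>1\<close>, makes the functional normalizable and keeps
    \<open>S\<close> nonempty when \<open>K\<close> is the whole space.\<close>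
  define S where "S = insert (1, 0) ((\<lambda>u. b u u) ` (sphere 0 1 \<inter> K\<^sup>\<bottom>))"
  have "closed (K\<^sup>\<bottom>)"
    by (intro closed_subspace subspace_orthogonal_comp)
  then have "compact S"
    unfolding S_def b_def
    by (intro compact_insert compact_continuous_image compact_Int_closed compact_sphere
        continuous_intros)
  moreover have "S \<subseteq> E - uminus ` E"
  proof
    fix y assume "y \<in> S"
    then consider "y = (1, 0)" | u where "norm u = 1" "u \<in> K\<^sup>\<bottom>" "y = b u u"
      by (auto simp: S_def)
    then have "y \<in> E \<and> - y \<notin> E"
    proof cases
      case 1
      have "affine_poly (- (1, 0 :: real ^ 'n)) = - 1"
        by (simp only: affine_poly_uminus affine_poly_one)
      then show ?thesis using ND(1) N(2) 1 by (simp add: E_def)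
    next
      case (2 u)
      have "u \<notin> K"
      proof
        assume "u \<in> K"
        then have "u \<bullet> u = 0" using 2(2) by (auto simp: orthogonal_comp_def orthogonal_def)
        with 2(1) show False by simp
      qed
      with 2 quadE isotropic show ?thesis by auto
    qed
    then show "y \<in> E - uminus ` E" by auto
  qed
  ultimately obtain a where pos: "\<And>y. y \<in> S \<Longrightarrow> 0 < a \<bullet> y"
    and null: "\<And>y. y \<in> E \<Longrightarrow> - y \<in> E \<Longrightarrow> a \<bullet> y = 0"
    using exists_functional_positive_on_compact[OF E, of S] by (auto simp: S_def)
  have a1: "0 < fst a"
    using pos[of "(1, 0)"] by (simp add: S_def inner_prod_def)
  define x where "x = snd a /\<^sub>R fst a"
  have eval: "eval_rpoly (affine_poly y) x = (a \<bullet> y) / fst a" for y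
    using a1 by (simp add: eval_affine_poly x_def inner_prod_def field_simps inner_commute)
  let ?A = "eval_pencil L x"
  have A: "bilin ?A u w = (a \<bullet> b u w) / fst a" for u w
  proof -
    have "bilin ?A u w = eval_rpoly (bilin L (cvec u) (cvec w)) x"
      by (simp add: eval_rpoly_bilin cvec_def eval_rpoly_single)
    then show ?thesis by (simp add: b[symmetric] eval)
  qed
  have symA: "transpose ?A = ?A"
    unfolding vec_eq_iff
    by (simp add: eval_pencil_def transpose_def symmetric_matrix_entry[OF sym])
  have "0 \<le> bilin ?A v v" for v
  proof -
    have "v \<in> K + K\<^sup>\<bottom>" using subspace_sum_orthogonal_comp[OF K] by simp
    then obtain k u where v: "v = k + u" "k \<in> K" "u \<in> K\<^sup>\<bottom>" by (auto elim: set_plus_elim)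
    have K0: "bilin ?A k w = 0" for w
      using v(2) null by (simp add: A K_def W_def)
    have "bilin ?A v v = bilin ?A u u"
      unfolding v(1) bilin_add_left bilin_add_right
      using K0 bilin_commute[OF symA, of u k] by simp
    also have "0 \<le> bilin ?A u u"
    proof (cases "u = 0")
      case True
      then show ?thesis by (simp add: bilin_def)
    next
      case False
      have "(1 / norm u) *\<^sub>R u \<in> K\<^sup>\<bottom>"
        using v(3) subspace_orthogonal_comp subspace_scale by blast
      then have "b ((1 / norm u) *\<^sub>R u) ((1 / norm u) *\<^sub>R u) \<in> S"
        unfolding S_def using False by (intro insertI2 imageI) simp
      from pos[OF this] have "0 < a \<bullet> b u u"
        using False by (simp add: b_scale zero_less_divide_iff zero_less_mult_iff)
      then show ?thesis using a1 by (simp add: A)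
    qed
    finally show ?thesis .
  qed
  then have "x \<in> spectrahedron L"
    using symA by (simp add: spectrahedron_def pos_semidef_def inner_matrix_eq_bilin)
  then show ?thesis by blast
qed

theorem theorem2p2p5:
  fixes L :: "'n::finite rpoly ^ 'm::finite ^ 'm"
  assumes "linear_pencil L"
  shows "spectrahedron L = {} \<longleftrightarrow> - 1 \<in> quadratic_module L"
proof
  show "- 1 \<in> quadratic_module L" if empty: "spectrahedron L = {}"
  proof (rule ccontr)
    assume "- 1 \<notin> quadratic_module L"
    then obtain N where N: "quadratic_module L \<subseteq> N" "is_quadratic_module N" "-1 \<notin> N"
      and max: "\<And>N'. is_quadratic_module N' \<Longrightarrow> -1 \<notin> N' \<Longrightarrow> N \<subseteq> N' \<Longrightarrow> N' = N"
      using exists_maximal_proper_quadratic_module[OF is_quadratic_module_quadratic_module] by metis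
    have "spectrahedron L \<noteq> {}"
      using assms N(2,3) maximal_quadratic_module_real[OF N(2,3) max]
    proof (rule spectrahedron_nonempty_of_real_quadratic_module)
      show "quad_form L v \<in> N" for v
        using N(1) quad_form_in_quadratic_module by blast
    qed
    with empty show False by simp
  qed
  show "spectrahedron L = {}" if "- 1 \<in> quadratic_module L"
  proof (rule ccontr)
    assume "spectrahedron L \<noteq> {}"
    then obtain x where "x \<in> spectrahedron L" by blast
    from eval_quadratic_module_nonneg[OF that this] show False
      by (simp add: eval_rpoly_uminus)
  qed
qed

end
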